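(* There are absolute constants $C_1, C_2$ such that the following holds. Let $\Delta\ge 1$ and $q$ be integers with $q\ge C_1\Delta$, and let $H=(V,E)$ be a bipartite graph with $|V|=2q$ and balanced bipartition $V=[q]\sqcup[q]$. Suppose that $H$ has minimum degree at least $q-\Delta$. Let $e\in E$ be an edge of $H$, let $\mathcal{L}$ be the set of perfect matchings of $H$ containing $e$, and let $\mathcal{R}$ be the set of perfect matchings of $H$ not containing $e$. Then there is a coupling $\gamma$ of $\mathcal{U}_{\mathcal{R}}$ and $\mathcal{U}_{\mathcal{L}\cup\mathcal{R}}$ such that \[ \mathbb{E}_{(\rho,\rho')\sim\gamma}[d_{\mathrm{C}}(\rho,\rho')]\le \frac{C_2\Delta}{q}. \]
   Context: Here $[q]=\{1,\dots,q\}$ and $[q]\sqcup[q]$ is the disjoint union of two copies (left and right) of $[q]$; an edge $(i,j)$ joins $i$ in the left copy to $j$ in the right copy. A perfect matching of $H$ is identified with the permutation $\rho\in S_q$ such that $(i,\rho(i))\in E$ for each $i$ (the matching edges being the $(i,\rho(i))$). For a nonempty finite set $A$, $\mathcal{U}_A$ is the uniform distribution on $A$. $d_{\mathrm{C}}$ is the Cayley metric on the symmetric group $S_q$: $d_{\mathrm{C}}(\rho,\rho')$ is the minimum number of transpositions which one must compose with $\rho$ to turn it into $\rho'$ (graph distance in the Cayley graph of $S_q$ generated by all transpositions). A coupling of two probability distributions $\mu,\nu$ is a joint distribution of pairs whose first marginal is $\mu$ and second marginal is $\nu$. *)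

theory Defs
  imports "HOL-Probability.Probability" "HOL-Combinatorics.Permutations"
begin

text \<open>
  A bipartite graph on \<open>[q] \<squnion> [q]\<close> is given by its edge set \<open>E \<subseteq> {1..q} \<times> {1..q}\<close>; the pair
  \<open>(i, j)\<close> joins the left vertex \<open>Inl i\<close> to the right vertex \<open>Inr j\<close>.
\<close>

definition bip_vertices :: "nat \<Rightarrow> (nat + nat) set" where
  "bip_vertices q = {1..q} <+> {1..q}"

fun bip_degree :: "(nat \<times> nat) set \<Rightarrow> nat + nat \<Rightarrow> nat" where
  "bip_degree E (Inl i) = card {j. (i, j) \<in> E}"
| "bip_degree E (Inr j) = card {i. (i, j) \<in> E}"

definition matching_edges :: "nat \<Rightarrow> (nat \<Rightarrow> nat) \<Rightarrow> (nat \<times> nat) set" where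
  "matching_edges q \<rho> = {(i, \<rho> i) | i. i \<in> {1..q}}"

text \<open>
  Perfect matchings are identified with permutations. Since \<open>\<rho> permutes {1..q}\<close> makes \<open>\<rho>\<close> the
  identity outside \<open>{1..q}\<close>, distinct functions in this set are distinct matchings.
\<close>

definition perfect_matchings :: "nat \<Rightarrow> (nat \<times> nat) set \<Rightarrow> (nat \<Rightarrow> nat) set" where
  "perfect_matchings q E = {\<rho>. \<rho> permutes {1..q} \<and> matching_edges q \<rho> \<subseteq> E}"

definition cayley_graph :: "nat \<Rightarrow> ((nat \<Rightarrow> nat) \<times> (nat \<Rightarrow> nat)) set" where
  "cayley_graph q =
     {(\<sigma>, \<sigma> \<circ> Transposition.transpose a b) | \<sigma> a b.
        \<sigma> permutes {1..q} \<and> a \<in> {1..q} \<and> b \<in> {1..q} \<and> a \<noteq> b}"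

text \<open>
  Graph distance; the relational power \<open>cayley_graph q ^^ k\<close> relates the endpoints of walks of
  length \<open>k\<close>. Only meaningful when both arguments permute \<open>{1..q}\<close>.
\<close>

definition cayley_dist :: "nat \<Rightarrow> (nat \<Rightarrow> nat) \<Rightarrow> (nat \<Rightarrow> nat) \<Rightarrow> nat" where
  "cayley_dist q \<rho> \<rho>' = (LEAST k. (\<rho>, \<rho>') \<in> cayley_graph q ^^ k)"

definition is_coupling :: "('a \<times> 'b) pmf \<Rightarrow> 'a pmf \<Rightarrow> 'b pmf \<Rightarrow> bool" where
  "is_coupling \<gamma> \<mu> \<nu> \<longleftrightarrow> map_pmf fst \<gamma> = \<mu> \<and> map_pmf snd \<gamma> = \<nu>"

end

theory Submission
  imports Defs
begin

text \<open>
  Let \<open>e = (a, b)\<close>. Swapping the values of \<open>\<rho> \<in> R\<close> at \<open>a\<close> and \<open>\<rho>\<^sup>-\<^sup>1 b\<close> gives a matching in \<open>L\<close> as soon as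
  \<open>(\<rho>\<^sup>-\<^sup>1 b, \<rho> a) \<in> E\<close>; every element of \<open>L\<close> arises in this way from between \<open>q - 2\<Delta> - 1\<close> and \<open>q\<close> elements
  of \<open>R\<close>, and a second switching shows that all but a fraction \<open>O(\<Delta>/q)\<close> of \<open>R\<close> can be switched.
  Hence \<open>L\<close> has density \<open>O(1/q)\<close>. Keep \<open>\<rho>\<close> fixed with the largest weight the marginals permit
  and transport along switches, at distance 1, to reach \<open>L\<close>; this exhausts the marginals up to a mass of
  \<open>O(\<Delta>/q\<^sup>2)\<close>. The remaining mass can be coupled arbitrarily, as two permutations are always at
  distance at most \<open>q\<close>.
\<close>

section \<open>Completing a partial coupling to a coupling\<close>

lemma subcoupling_extends:
  fixes \<mu> :: "'a pmf" and \<nu> :: "'b pmf" and w d :: "'a \<Rightarrow> 'b \<Rightarrow> real" and D :: real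
  defines "A \<equiv> set_pmf \<mu>" and "B \<equiv> set_pmf \<nu>"
  assumes fin: "finite A" "finite B"
    and w_nonneg: "\<And>x y. x \<in> A \<Longrightarrow> y \<in> B \<Longrightarrow> w x y \<ge> 0"
    and row: "\<And>x. x \<in> A \<Longrightarrow> (\<Sum>y\<in>B. w x y) \<le> pmf \<mu> x"
    and col: "\<And>y. y \<in> B \<Longrightarrow> (\<Sum>x\<in>A. w x y) \<le> pmf \<nu> y"
    and d_le: "\<And>x y. x \<in> A \<Longrightarrow> y \<in> B \<Longrightarrow> d x y \<le> D"
  shows "\<exists>\<gamma>. is_coupling \<gamma> \<mu> \<nu> \<and>
           measure_pmf.expectation \<gamma> (\<lambda>(x, y). d x y)
             \<le> (\<Sum>x\<in>A. \<Sum>y\<in>B. w x y * d x y) + D * (1 - (\<Sum>x\<in>A. \<Sum>y\<in>B. w x y))"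
proof -
  \<comment> \<open>The coupling is \<open>w\<close> plus the normalised product \<open>r x * s y / m\<close> of the leftover marginals;
    if \<open>m = 0\<close> then \<open>r\<close> and \<open>s\<close> vanish and division by zero does no harm.\<close>
  define r where "r x = pmf \<mu> x - (\<Sum>y\<in>B. w x y)" for x
  define s where "s y = pmf \<nu> y - (\<Sum>x\<in>A. w x y)" for y
  define m where "m = 1 - (\<Sum>x\<in>A. \<Sum>y\<in>B. w x y)"
  have r_nonneg: "r x \<ge> 0" if "x \<in> A" for x using row[OF that] by (simp add: r_def)
  have s_nonneg: "s y \<ge> 0" if "y \<in> B" for y using col[OF that] by (simp add: s_def)
  \<comment> \<open>The two leftover marginals have the same total mass \<open>m\<close>; hence
    their product divided by \<open>m\<close> has exactly \<open>r\<close> and \<open>s\<close> as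
    marginals.\<close>
  have sum_r: "sum r A = m"
    unfolding r_def m_def sum_subtractf using fin by (simp add: A_def sum_pmf_eq_1)
  have sum_s: "sum s B = m"
    unfolding s_def m_def sum_subtractf using fin
    by (subst (2) sum.swap) (simp add: B_def sum_pmf_eq_1)
  have m_nonneg: "m \<ge> 0" using sum_r r_nonneg by (metis sum_nonneg)
  have r_eq: "r x * m / m = r x" if "x \<in> A" for x
  proof (cases "m = 0")
    case True
    then have "r x = 0" using sum_r r_nonneg that fin sum_nonneg_eq_0_iff[of A r] by auto
    then show ?thesis by simp
  qed simp
  have s_eq: "m * s y / m = s y" if "y \<in> B" for y
  proof (cases "m = 0")
    case True
    then have "s y = 0" using sum_s s_nonneg that fin sum_nonneg_eq_0_iff[of B s] by auto
    then show ?thesis by simp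
  qed simp
  define h where "h x y = w x y + r x * s y / m" for x y
  \<comment> \<open>\<open>embed_pmf\<close> takes a function on the whole product type, so
    \<open>h\<close> is cut off to zero outside the supports, where it could be negative.\<close>
  define g where "g = (\<lambda>(x, y). if x \<in> A \<and> y \<in> B then h x y else 0)"
  have h_nonneg: "h x y \<ge> 0" if "x \<in> A" "y \<in> B" for x y
    unfolding h_def using w_nonneg r_nonneg s_nonneg m_nonneg that by simp
  have row_h: "(\<Sum>y\<in>B. h x y) = pmf \<mu> x" if "x \<in> A" for x
  proof -
    have "(\<Sum>y\<in>B. h x y) = (\<Sum>y\<in>B. w x y) + r x * sum s B / m"
      by (simp add: h_def sum.distrib sum_distrib_left sum_divide_distrib)
    then show ?thesis using r_eq[OF that] by (simp add: sum_s r_def)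
  qed
  have col_h: "(\<Sum>x\<in>A. h x y) = pmf \<nu> y" if "y \<in> B" for y
  proof -
    have "(\<Sum>x\<in>A. h x y) = (\<Sum>x\<in>A. w x y) + sum r A * s y / m"
      by (simp add: h_def sum.distrib sum_distrib_right sum_divide_distrib)
    then show ?thesis using s_eq[OF that] by (simp add: sum_r s_def)
  qed
  have g_nonneg: "g z \<ge> 0" for z
    using h_nonneg by (auto simp: g_def split: prod.split)
  have sum_g: "(\<Sum>z\<in>A \<times> B. g z) = 1"
  proof -
    have "(\<Sum>z\<in>A \<times> B. g z) = (\<Sum>x\<in>A. \<Sum>y\<in>B. h x y)"
      by (subst sum.cartesian_product) (rule sum.cong, auto simp: g_def)
    also have "\<dots> = (\<Sum>x\<in>A. pmf \<mu> x)" by (simp add: row_h)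
    finally show ?thesis using fin by (simp add: A_def sum_pmf_eq_1)
  qed
  have "(\<integral>\<^sup>+ z. ennreal (g z) \<partial>count_space UNIV) = (\<Sum>z\<in>A \<times> B. ennreal (g z))"
    by (rule nn_integral_count_space'[OF finite_cartesian_product[OF fin]])
       (auto simp: g_def split: if_splits)
  also have "\<dots> = 1" using sum_g g_nonneg by (simp add: sum_ennreal)
  finally have int_g: "(\<integral>\<^sup>+ z. ennreal (g z) \<partial>count_space UNIV) = 1" .
  define \<gamma> where "\<gamma> = embed_pmf g"
  have pmf_\<gamma>: "pmf \<gamma> z = g z" for z
    unfolding \<gamma>_def by (rule pmf_embed_pmf[OF g_nonneg int_g])
  have supp: "set_pmf \<gamma> \<subseteq> A \<times> B"
    by (auto simp: set_pmf_eq pmf_\<gamma> g_def split: if_splits)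
  have expect: "measure_pmf.expectation \<gamma> f = (\<Sum>x\<in>A. \<Sum>y\<in>B. h x y * f (x, y))" for f :: "_ \<Rightarrow> real"
  proof -
    have "measure_pmf.expectation \<gamma> f = (\<Sum>z\<in>A \<times> B. f z * pmf \<gamma> z)"
      by (rule integral_measure_pmf_real) (use fin supp in auto)
    also have "\<dots> = (\<Sum>x\<in>A. \<Sum>y\<in>B. h x y * f (x, y))"
      by (subst sum.cartesian_product) (rule sum.cong, auto simp: g_def pmf_\<gamma>)
    finally show ?thesis .
  qed
  have "map_pmf fst \<gamma> = \<mu>"
  proof (rule pmf_eqI)
    fix x
    \<comment> \<open>Writing the marginal as the expectation of an indicator lets
      \<open>expect\<close> evaluate it. For \<open>x\<close> outside the support both sides
      vanish.\<close>
    have "pmf (map_pmf fst \<gamma>) x = measure_pmf.expectation \<gamma> (indicator (fst -` {x}))"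
      by (simp add: pmf_map)
    also have "\<dots> = (\<Sum>x'\<in>A. if x' = x then \<Sum>y\<in>B. h x y else 0)"
      unfolding expect by (rule sum.cong) (auto simp: indicator_def)
    also have "\<dots> = pmf \<mu> x"
      using fin row_h by (simp add: A_def set_pmf_eq)
    finally show "pmf (map_pmf fst \<gamma>) x = pmf \<mu> x" .
  qed
  moreover have "map_pmf snd \<gamma> = \<nu>"
  proof (rule pmf_eqI)
    fix y
    have "pmf (map_pmf snd \<gamma>) y = measure_pmf.expectation \<gamma> (indicator (snd -` {y}))"
      by (simp add: pmf_map)
    also have "\<dots> = (\<Sum>y'\<in>B. if y' = y then \<Sum>x\<in>A. h x y else 0)"
      unfolding expect by (subst sum.swap, rule sum.cong) (auto simp: indicator_def)
    also have "\<dots> = pmf \<nu> y"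
      using fin col_h by (simp add: B_def set_pmf_eq)
    finally show "pmf (map_pmf snd \<gamma>) y = pmf \<nu> y" .
  qed
  moreover have "measure_pmf.expectation \<gamma> (\<lambda>(x, y). d x y)
      \<le> (\<Sum>x\<in>A. \<Sum>y\<in>B. w x y * d x y) + D * m"
  proof -
    have "measure_pmf.expectation \<gamma> (\<lambda>(x, y). d x y)
        \<le> (\<Sum>x\<in>A. \<Sum>y\<in>B. w x y * d x y + r x * s y / m * D)"
      unfolding expect
      by (auto intro!: sum_mono mult_left_mono d_le
            simp: h_def distrib_right r_nonneg s_nonneg m_nonneg simp del: times_divide_eq_left)
    \<comment> \<open>The product part has total mass \<open>m * m / m = m\<close>, so the leftover
      contributes at most \<open>D * m\<close>.\<close>
    also have "\<dots> = (\<Sum>x\<in>A. \<Sum>y\<in>B. w x y * d x y) + (sum r A * sum s B) / m * D"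
      by (simp add: sum.distrib sum_divide_distrib[symmetric] sum_distrib_right[symmetric]
          sum_product[symmetric])
    also have "\<dots> = (\<Sum>x\<in>A. \<Sum>y\<in>B. w x y * d x y) + D * m" by (simp add: sum_r sum_s)
    finally show ?thesis .
  qed
  ultimately show ?thesis unfolding is_coupling_def m_def by blast
qed

section \<open>Bounds on the Cayley distance\<close>

lemma cayley_dist_le:
  assumes "(\<rho>, \<rho>') \<in> cayley_graph q ^^ k"
  shows "cayley_dist q \<rho> \<rho>' \<le> k"
  unfolding cayley_dist_def using assms by (rule Least_le)

lemma cayley_dist_refl: "cayley_dist q \<rho> \<rho> = 0"
  using cayley_dist_le[of \<rho> \<rho> 0 q] by simp

lemma cayley_dist_transpose_le:
  assumes "\<rho> permutes {1..q}" "a \<in> {1..q}" "b \<in> {1..q}" "a \<noteq> b"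
  shows "cayley_dist q \<rho> (\<rho> \<circ> Transposition.transpose a b) \<le> 1"
  by (rule cayley_dist_le) (use assms in \<open>auto simp: cayley_graph_def\<close>)

lemma permutes_comp_transpose:
  assumes "\<rho> permutes S" "a \<in> S" "b \<in> S"
  shows "\<rho> \<circ> Transposition.transpose a b permutes S"
  using permutes_compose[OF permutes_swap_id[OF assms(2,3)] assms(1)] .

lemma cayley_dist_le_card:
  assumes "\<rho> permutes {1..q}" "\<rho>' permutes {1..q}"
  shows "cayley_dist q \<rho> \<rho>' \<le> q"
proof -
  \<comment> \<open>A suitable transposition decreases the number of disagreements.\<close>
  have "\<exists>k \<le> card {i \<in> {1..q}. \<rho> i \<noteq> \<rho>' i}. (\<rho>, \<rho>') \<in> cayley_graph q ^^ k"
    using assms(1)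
  proof (induction "card {i \<in> {1..q}. \<rho> i \<noteq> \<rho>' i}" arbitrary: \<rho> rule: less_induct)
    case less
    show ?case
    proof (cases "\<rho> = \<rho>'")
      case True
      then show ?thesis by (intro exI[of _ 0]) simp
    next
      case False
      then obtain i where i: "\<rho> i \<noteq> \<rho>' i" by auto
      then have iq: "i \<in> {1..q}" using less.prems assms(2) permutes_not_in by metis
      \<comment> \<open>\<open>k\<close> is where \<open>\<rho>\<close> takes the value wanted at
        \<open>i\<close>. Swapping creates agreement at \<open>i\<close>, and none is lost at
        \<open>k\<close>: there \<open>\<rho>\<close> has the value \<open>\<rho>' i\<close>, which
        differs from \<open>\<rho>' k\<close>.\<close>
      define k where "k = inv \<rho> (\<rho>' i)"
      have k: "\<rho> k = \<rho>' i" unfolding k_def using less.prems by (simp add: permutes_inverses)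
      have kq: "k \<in> {1..q}"
        using k iq less.prems assms(2) by (metis permutes_in_image)
      have ki: "k \<noteq> i" using k i by auto
      define \<tau> where "\<tau> = \<rho> \<circ> Transposition.transpose i k"
      have \<tau>: "\<tau> permutes {1..q}"
        unfolding \<tau>_def using less.prems iq kq by (rule permutes_comp_transpose)
      have inj: "\<rho>' x = \<rho>' y \<longleftrightarrow> x = y" for x y
        using assms(2) permutes_inj by (metis injD)
      have "{j \<in> {1..q}. \<tau> j \<noteq> \<rho>' j} \<subset> {j \<in> {1..q}. \<rho> j \<noteq> \<rho>' j}"
      proof
        show "{j \<in> {1..q}. \<tau> j \<noteq> \<rho>' j} \<subseteq> {j \<in> {1..q}. \<rho> j \<noteq> \<rho>' j}"
          using k ki by (auto simp: \<tau>_def Transposition.transpose_def inj split: if_splits)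
        show "{j \<in> {1..q}. \<tau> j \<noteq> \<rho>' j} \<noteq> {j \<in> {1..q}. \<rho> j \<noteq> \<rho>' j}"
          using k iq i by (auto simp: \<tau>_def set_eq_iff intro!: exI[of _ i])
      qed
      then have lt: "card {j \<in> {1..q}. \<tau> j \<noteq> \<rho>' j} < card {j \<in> {1..q}. \<rho> j \<noteq> \<rho>' j}"
        by (intro psubset_card_mono) auto
      from less.hyps[OF lt \<tau>] obtain n where
        n: "n \<le> card {j \<in> {1..q}. \<tau> j \<noteq> \<rho>' j}" "(\<tau>, \<rho>') \<in> cayley_graph q ^^ n" by auto
      have "(\<rho>, \<tau>) \<in> cayley_graph q"
        using less.prems iq kq ki by (auto simp: cayley_graph_def \<tau>_def)
      then have "(\<rho>, \<rho>') \<in> cayley_graph q ^^ Suc n" using n(2) by (rule relpow_Suc_I2)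
      then show ?thesis using n(1) lt by (intro exI[of _ "Suc n"]) auto
    qed
  qed
  then obtain k where "k \<le> card {i \<in> {1..q}. \<rho> i \<noteq> \<rho>' i}" "(\<rho>, \<rho>') \<in> cayley_graph q ^^ k"
    by auto
  moreover have "card {i \<in> {1..q}. \<rho> i \<noteq> \<rho>' i} \<le> q"
    using card_mono[of "{1..q}" "{i \<in> {1..q}. \<rho> i \<noteq> \<rho>' i}"]
    by (metis (lifting) card_atLeastAtMost diff_Suc_1 finite_atLeastAtMost mem_Collect_eq subsetI)
  ultimately show ?thesis using cayley_dist_le[of \<rho> \<rho>' k q] by linarith
qed

section \<open>Perfect matchings and the number of available switches\<close>

lemma perfect_matchings_iff:
  "\<rho> \<in> perfect_matchings q E \<longleftrightarrow> \<rho> permutes {1..q} \<and> (\<forall>i \<in> {1..q}. (i, \<rho> i) \<in> E)"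
proof -
  have "matching_edges q \<rho> = (\<lambda>i. (i, \<rho> i)) ` {1..q}"
    unfolding matching_edges_def by (rule Setcompr_eq_image)
  then show ?thesis by (simp only: perfect_matchings_def mem_Collect_eq image_subset_iff)
qed

lemma finite_perfect_matchings: "finite (perfect_matchings q E)"
  unfolding perfect_matchings_def
  by (rule finite_subset[OF _ finite_permutations[OF finite_atLeastAtMost[of 1 q]]]) blast

lemma perfect_matching_switch:
  assumes "\<rho> \<in> perfect_matchings q E" "x \<in> {1..q}" "k \<in> {1..q}" "(x, \<rho> k) \<in> E" "(k, \<rho> x) \<in> E"
  shows "\<rho> \<circ> Transposition.transpose x k \<in> perfect_matchings q E"
  unfolding perfect_matchings_iff
proof (intro conjI ballI)
  show "\<rho> \<circ> Transposition.transpose x k permutes {1..q}"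
    using assms by (intro permutes_comp_transpose) (simp_all add: perfect_matchings_def)
  fix i assume "i \<in> {1..q}"
  then have "(i, \<rho> i) \<in> E" using assms(1) unfolding perfect_matchings_iff by blast
  then show "(i, (\<rho> \<circ> Transposition.transpose x k) i) \<in> E"
    using assms(4,5) by (simp add: Transposition.transpose_def)
qed

text \<open>The degree condition is kept as a bound on nonneighbours because the counts below are
  union bounds over excluded indices, at most \<open>\<Delta>\<close> for each edge
  required.\<close>

locale dense_bipartite =
  fixes q \<Delta> :: nat and E :: "(nat \<times> nat) set"
  assumes nonneighbours_left: "i \<in> {1..q} \<Longrightarrow> card {j \<in> {1..q}. (i, j) \<notin> E} \<le> \<Delta>"
    and nonneighbours_right: "j \<in> {1..q} \<Longrightarrow> card {i \<in> {1..q}. (i, j) \<notin> E} \<le> \<Delta>"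
begin

lemma card_permuted_nonneighbours:
  assumes "\<rho> permutes {1..q}" "x \<in> {1..q}"
  shows "card {k \<in> {1..q}. (x, \<rho> k) \<notin> E} \<le> \<Delta>"
proof -
  have "card {k \<in> {1..q}. (x, \<rho> k) \<notin> E} \<le> card {j \<in> {1..q}. (x, j) \<notin> E}"
  proof (rule card_inj_on_le)
    show "inj_on \<rho> {k \<in> {1..q}. (x, \<rho> k) \<notin> E}" using assms(1) by (rule permutes_inj_on)
    show "\<rho> ` {k \<in> {1..q}. (x, \<rho> k) \<notin> E} \<subseteq> {j \<in> {1..q}. (x, j) \<notin> E}"
      using permutes_imp_bij[OF assms(1)] by (blast dest: bij_betwE)
  qed simp
  then show ?thesis using nonneighbours_left[OF assms(2)] by linarith
qed

text \<open>For \<open>y = \<rho> x\<close> these \<open>k\<close> are the positions whose swap with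
  \<open>x\<close> puts edges at both places. Each of the two conditions excludes at most
  \<open>\<Delta>\<close> indices. The count is stated for arbitrary permutations so that it also
  serves the extremal argument for the existence of a matching.\<close>

lemma card_switches:
  assumes "\<rho> permutes {1..q}" "x \<in> {1..q}" "y \<in> {1..q}"
  shows "q \<le> card {k \<in> {1..q}. (x, \<rho> k) \<in> E \<and> (k, y) \<in> E} + 2 * \<Delta>"
proof -
  let ?G = "{k \<in> {1..q}. (x, \<rho> k) \<in> E \<and> (k, y) \<in> E}"
  let ?A = "{k \<in> {1..q}. (x, \<rho> k) \<notin> E}" and ?B = "{k \<in> {1..q}. (k, y) \<notin> E}"
  have "{1..q} = ?G \<union> (?A \<union> ?B)" by auto
  from arg_cong[OF this, of card] have "q = card (?G \<union> (?A \<union> ?B))" by simp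
  also have "\<dots> \<le> card ?G + (card ?A + card ?B)"
    using card_Un_le[of ?G "?A \<union> ?B"] card_Un_le[of ?A ?B] by linarith
  finally show ?thesis
    using card_permuted_nonneighbours[OF assms(1,2)] nonneighbours_right[OF assms(3)] by linarith
qed

lemma perfect_matchings_nonempty:
  assumes "2 * \<Delta> < q"
  shows "perfect_matchings q E \<noteq> {}"
proof -
  \<comment> \<open>A permutation using the maximal number of edges uses only edges.\<close>
  let ?good = "\<lambda>\<rho>. {i \<in> {1..q}. (i, \<rho> i) \<in> E}"
  have "card (?good \<tau>) < Suc q" for \<tau> :: "nat \<Rightarrow> nat"
    using card_mono[of "{1..q}" "?good \<tau>"] by (simp add: less_Suc_eq_le Collect_mono_iff subset_iff)
  then obtain \<rho> where \<rho>: "\<rho> permutes {1..q}"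
    and max: "\<And>\<tau>. \<tau> permutes {1..q} \<Longrightarrow> card (?good \<tau>) \<le> card (?good \<rho>)"
    using ex_has_greatest_nat[of "\<lambda>\<rho>. \<rho> permutes {1..q}" id "\<lambda>\<rho>. card (?good \<rho>)" "Suc q"]
      permutes_id[of "{1..q}"] by blast
  have "(i, \<rho> i) \<in> E" if i: "i \<in> {1..q}" for i
  proof (rule ccontr)
    assume bad: "(i, \<rho> i) \<notin> E"
    have "\<rho> i \<in> {1..q}" using i \<rho> by (simp only: permutes_in_image)
    then have "card {k \<in> {1..q}. (i, \<rho> k) \<in> E \<and> (k, \<rho> i) \<in> E} \<noteq> 0"
      using card_switches[OF \<rho> i, of "\<rho> i"] assms by linarith
    then obtain k where k: "k \<in> {1..q}" "(i, \<rho> k) \<in> E" "(k, \<rho> i) \<in> E"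
      by (metis (mono_tags, lifting) card.empty empty_Collect_eq)
    define \<tau> where "\<tau> = \<rho> \<circ> Transposition.transpose i k"
    \<comment> \<open>\<open>k\<close> differs from \<open>i\<close>, since
      \<open>(k, \<rho> i)\<close> is an edge and \<open>(i, \<rho> i)\<close> is not. After the
      swap both positions carry edges and all others are unchanged, so \<open>i\<close> is gained
      and nothing is lost.\<close>
    have "?good \<rho> \<subset> ?good \<tau>"
      using k bad i by (auto simp: \<tau>_def Transposition.transpose_def)
    then have "card (?good \<rho>) < card (?good \<tau>)" by (intro psubset_card_mono) auto
    moreover have "\<tau> permutes {1..q}"
      unfolding \<tau>_def using \<rho> i k(1) by (rule permutes_comp_transpose)
    ultimately show False using max[of \<tau>] by simp
  qed
  then have "\<rho> \<in> perfect_matchings q E" unfolding perfect_matchings_iff using \<rho> by simp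
  then show ?thesis by blast
qed

end

section \<open>The numerical estimate of the cost\<close>

text \<open>\<open>l\<close>, \<open>r\<close>, \<open>s\<close> stand for the sizes of
  \<open>L\<close>, \<open>R\<close> and \<open>switchable\<close>, and \<open>t\<close> for the
  weight of a switch. Whichever term attains the minimum, the uncovered part
  \<open>l - t * s\<close> is at most \<open>3 * \<Delta> * l / q\<close>, so the numerator is at
  most \<open>4 * \<Delta> * l\<close>; the rest is \<open>l / r \<le> 2 / q\<close>.\<close>

lemma switching_cost_bound:
  fixes l r s q \<Delta> t :: real
  assumes "0 \<le> l" "0 < r" "s \<le> r" "1 \<le> \<Delta>" "6 * \<Delta> \<le> q"
    and l_s: "l * (q - 3 * \<Delta>) \<le> s"
    and r_s: "(r - s) * (q - 2 * \<Delta>) \<le> r * \<Delta>"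
    and t: "t = min (1 / q) (l / r)"
  shows "(t * s + q * (l - t * s)) / (l + r) \<le> 8 * \<Delta> / q"
proof -
  have q: "0 < q" using assms by linarith
  have "0 \<le> l * (q - 3 * \<Delta>)" using assms by (intro mult_nonneg_nonneg) auto
  then have s: "0 \<le> s" using l_s by linarith
  have "t * s \<le> l / r * s" using s by (intro mult_right_mono) (simp_all add: t)
  also have "\<dots> \<le> l / r * r" using assms by (intro mult_left_mono) auto
  finally have ts: "t * s \<le> l" using assms by simp
  have deficit: "q * (l - t * s) \<le> 3 * \<Delta> * l"
  \<comment> \<open>For \<open>t = 1 / q\<close> the deficit is small because the fibres over
    \<open>L\<close> have nearly \<open>q\<close> elements. For \<open>t = l / r\<close> the rows of
    switchable matchings are used up, and the deficit \<open>l * (r - s) / r\<close> comes from the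
    nonswitchable ones alone.\<close>
  proof (cases "1 / q \<le> l / r")
    case True
    then have "t = 1 / q" by (simp add: t)
    then have "q * (t * s) = s" using q by simp
    then have "q * (l - t * s) = q * l - s" by (simp only: right_diff_distrib)
    also have "\<dots> \<le> 3 * \<Delta> * l" using l_s by (simp add: algebra_simps)
    finally show ?thesis .
  next
    case False
    then have tlr: "t = l / r" by (simp add: t)
    \<comment> \<open>\<open>6 * \<Delta> \<le> q\<close> gives
      \<open>q \<le> 3 * (q - 2 * \<Delta>)\<close>; the factor 3 leads to the same bound as in the
      other case.\<close>
    have "(r - s) * q \<le> (r - s) * (3 * (q - 2 * \<Delta>))"
      using assms by (intro mult_left_mono) auto
    also have "\<dots> = 3 * ((r - s) * (q - 2 * \<Delta>))" by simp
    also have "\<dots> \<le> 3 * (r * \<Delta>)" using r_s by linarith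
    finally have "l / r * ((r - s) * q) \<le> l / r * (3 * (r * \<Delta>))"
      using assms by (intro mult_left_mono) auto
    then show ?thesis using assms by (simp add: tlr field_simps)
  qed
  \<comment> \<open>Here \<open>6 * \<Delta> \<le> q\<close> is used in full, as
    \<open>q - 3 * \<Delta> \<ge> q / 2\<close>.\<close>
  have "l * (q / 2) \<le> l * (q - 3 * \<Delta>)" using assms by (intro mult_left_mono) auto
  then have lq: "l * q \<le> 2 * r" using l_s assms by simp
  have "l \<le> \<Delta> * l" using assms mult_right_mono[of 1 \<Delta> l] by simp
  then have "t * s + q * (l - t * s) \<le> 4 * \<Delta> * l" using deficit ts by simp
  then have "(t * s + q * (l - t * s)) * q \<le> (4 * \<Delta> * l) * q"
    using q by (intro mult_right_mono) auto
  also have "\<dots> = 4 * \<Delta> * (l * q)" by simp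
  also have "\<dots> \<le> 4 * \<Delta> * (2 * (l + r))" using lq assms by (intro mult_left_mono) auto
  finally show ?thesis using q assms by (simp add: field_simps)
qed

section \<open>Double counting of switches between \<open>R\<close> and \<open>L\<close>\<close>

locale dense_bipartite_edge = dense_bipartite +
  fixes a b :: nat
  assumes a: "a \<in> {1..q}" and b: "b \<in> {1..q}" and edge: "(a, b) \<in> E"
begin

definition L where "L = {\<rho> \<in> perfect_matchings q E. \<rho> a = b}"
definition R where "R = {\<rho> \<in> perfect_matchings q E. \<rho> a \<noteq> b}"

definition switchable where "switchable = {\<rho> \<in> R. (inv \<rho> b, \<rho> a) \<in> E}"

definition switch where "switch \<rho> = \<rho> \<circ> Transposition.transpose a (inv \<rho> b)" for \<rho> :: "nat \<Rightarrow> nat"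

lemma finite_L: "finite L" and finite_R: "finite R" and finite_switchable: "finite switchable"
  using finite_perfect_matchings[of q E] by (simp_all add: L_def R_def switchable_def)

lemma L_Un_R: "L \<union> R = perfect_matchings q E"
  unfolding L_def R_def by blast

lemma L_Int_R: "L \<inter> R = {}"
  unfolding L_def R_def by blast

lemma inv_matching:
  assumes "\<rho> permutes {1..q}"
  shows "\<rho> (inv \<rho> b) = b" "inv \<rho> b \<in> {1..q}" "\<rho> k = b \<Longrightarrow> inv \<rho> b = k"
proof -
  show "\<rho> (inv \<rho> b) = b" using assms by (rule permutes_inverses(1))
  show "inv \<rho> b \<in> {1..q}" using permutes_in_image[OF permutes_inv[OF assms]] b by (rule iffD2)
  show "\<rho> k = b \<Longrightarrow> inv \<rho> b = k" using permutes_inverses(2)[OF assms, of k] by simp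
qed

lemma L_permutes: "\<rho> \<in> L \<Longrightarrow> \<rho> permutes {1..q}"
  and R_permutes: "\<rho> \<in> R \<Longrightarrow> \<rho> permutes {1..q}"
  by (simp_all add: L_def R_def perfect_matchings_def)

lemma switch_in_L:
  assumes "\<rho> \<in> switchable"
  shows "switch \<rho> \<in> L"
proof -
  have \<rho>: "\<rho> \<in> perfect_matchings q E" "\<rho> permutes {1..q}" "(inv \<rho> b, \<rho> a) \<in> E"
    using assms by (auto simp: switchable_def R_def perfect_matchings_def)
  have "switch \<rho> \<in> perfect_matchings q E"
    unfolding switch_def using \<rho> inv_matching(1,2)[OF \<rho>(2)] a edge
    by (intro perfect_matching_switch) simp_all
  then show ?thesis using inv_matching(1)[OF \<rho>(2)] by (simp add: L_def switch_def)
qed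

text \<open>Switching leads from \<open>R\<close> to \<open>L\<close>, which are disjoint. Thus the
  two parts of the weight \<open>w\<close> below, staying and switching, never meet in one
  pair.\<close>

lemma switch_neq:
  assumes "\<rho> \<in> switchable"
  shows "switch \<rho> \<noteq> \<rho>"
  using switch_in_L[OF assms] assms L_Int_R unfolding switchable_def by (metis (lifting) disjoint_iff mem_Collect_eq)

lemma cayley_dist_switch_le:
  assumes "\<rho> \<in> switchable"
  shows "cayley_dist q \<rho> (switch \<rho>) \<le> 1"
proof -
  have \<rho>: "\<rho> permutes {1..q}" "\<rho> a \<noteq> b"
    using assms by (auto simp: switchable_def R_def perfect_matchings_def)
  have "a \<noteq> inv \<rho> b" using inv_matching(1)[OF \<rho>(1)] \<rho>(2) by metis
  from cayley_dist_transpose_le[OF \<rho>(1) a inv_matching(2)[OF \<rho>(1)] this]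
  show ?thesis by (simp only: switch_def)
qed

text \<open>A preimage of \<open>\<sigma>\<close> is determined by \<open>inv \<rho> b\<close>,
  because applying the same transposition again undoes the switch.\<close>

lemma card_switch_fibre_le:
  "card {\<rho> \<in> switchable. switch \<rho> = \<sigma>} \<le> q"
proof -
  have "card {\<rho> \<in> switchable. switch \<rho> = \<sigma>} \<le> card {1..q}"
  proof (rule card_inj_on_le)
    show "inj_on (\<lambda>\<rho>. inv \<rho> b) {\<rho> \<in> switchable. switch \<rho> = \<sigma>}"
    proof (rule inj_onI)
      fix \<rho> \<rho>' assume "\<rho> \<in> {\<rho> \<in> switchable. switch \<rho> = \<sigma>}" "\<rho>' \<in> {\<rho> \<in> switchable. switch \<rho> = \<sigma>}"
        and eq: "inv \<rho> b = inv \<rho>' b"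
      then have "switch \<rho> = switch \<rho>'" by simp
      then have "switch \<rho> \<circ> Transposition.transpose a (inv \<rho> b) =
          switch \<rho>' \<circ> Transposition.transpose a (inv \<rho>' b)" using eq by simp
      then show "\<rho> = \<rho>'" by (simp add: switch_def comp_assoc)
    qed
    show "(\<lambda>\<rho>. inv \<rho> b) ` {\<rho> \<in> switchable. switch \<rho> = \<sigma>} \<subseteq> {1..q}"
      using inv_matching(2) R_permutes unfolding switchable_def by blast
  qed simp
  then show ?thesis by simp
qed

text \<open>Preimages arise by swapping the values of \<open>\<sigma>\<close> at \<open>a\<close>
  and \<open>k\<close>, which makes \<open>k\<close> the new partner of \<open>b\<close>. The edge
  that switching back requires is \<open>(k, \<sigma> k)\<close>, already present in
  \<open>\<sigma>\<close>, so only the two new edges restrict \<open>k\<close>. The choice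
  \<open>k = a\<close> would return \<open>\<sigma>\<close> itself and accounts for the extra
  1.\<close>

lemma card_switch_fibre_ge:
  assumes "\<sigma> \<in> L"
  shows "q \<le> card {\<rho> \<in> switchable. switch \<rho> = \<sigma>} + 2 * \<Delta> + 1"
proof -
  let ?K = "{k \<in> {1..q}. (a, \<sigma> k) \<in> E \<and> (k, b) \<in> E}"
  let ?f = "\<lambda>k. \<sigma> \<circ> Transposition.transpose a k"
  have \<sigma>: "\<sigma> permutes {1..q}" "\<sigma> a = b" "\<sigma> \<in> perfect_matchings q E"
    using assms by (auto simp: L_def perfect_matchings_def)
  have inj: "\<sigma> x = \<sigma> y \<longleftrightarrow> x = y" for x y using permutes_inj[OF \<sigma>(1)] by (rule inj_eq)
  have "card (?K - {a}) \<le> card {\<rho> \<in> switchable. switch \<rho> = \<sigma>}"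
  proof (rule card_inj_on_le)
    show "inj_on ?f (?K - {a})"
    proof (rule inj_onI)
      fix k l assume "?f k = ?f l"
      \<comment> \<open>At \<open>k\<close> the left side is \<open>\<sigma> a\<close>, so
        transposing \<open>a\<close> and \<open>l\<close> must send \<open>k\<close> to
        \<open>a\<close>, which forces \<open>k = l\<close>.\<close>
      then have "?f k k = ?f l k" by simp
      then have "a = Transposition.transpose a l k" by (simp add: inj)
      then show "k = l" by (metis transpose_apply_first transpose_involutory)
    qed
    show "?f ` (?K - {a}) \<subseteq> {\<rho> \<in> switchable. switch \<rho> = \<sigma>}"
    proof
      fix \<rho> assume "\<rho> \<in> ?f ` (?K - {a})"
      then obtain k where k: "k \<in> {1..q}" "(a, \<sigma> k) \<in> E" "(k, b) \<in> E" "k \<noteq> a" and \<rho>: "\<rho> = ?f k"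
        by blast
      have pm: "\<rho> \<in> perfect_matchings q E"
        unfolding \<rho> using \<sigma> a k by (intro perfect_matching_switch) auto
      then have perm: "\<rho> permutes {1..q}" by (simp add: perfect_matchings_def)
      have \<rho>k: "inv \<rho> b = k" by (rule inv_matching(3)[OF perm]) (simp add: \<rho> \<sigma>)
      have \<rho>a: "\<rho> a = \<sigma> k" by (simp add: \<rho>)
      have "\<sigma> k \<noteq> b" using k(4) inj \<sigma>(2) by metis
      moreover have "(k, \<sigma> k) \<in> E" using \<sigma>(3) k(1) unfolding perfect_matchings_iff by blast
      ultimately have "\<rho> \<in> switchable"
        using pm by (simp add: switchable_def R_def \<rho>a \<rho>k)
      moreover have "switch \<rho> = \<sigma>"
        unfolding switch_def \<rho>k by (simp add: \<rho> comp_assoc)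
      ultimately show "\<rho> \<in> {\<rho> \<in> switchable. switch \<rho> = \<sigma>}" by simp
    qed
    show "finite {\<rho> \<in> switchable. switch \<rho> = \<sigma>}" using finite_switchable by simp
  qed
  moreover have "card ?K - card {a} \<le> card (?K - {a})"
    by (rule diff_card_le_card_Diff) simp
  ultimately show ?thesis using card_switches[OF \<sigma>(1) a b] by simp
qed

lemma card_switchable: "card switchable = (\<Sum>\<sigma>\<in>L. card {\<rho> \<in> switchable. switch \<rho> = \<sigma>})"
proof -
  have "switchable = (\<Union>\<sigma>\<in>L. {\<rho> \<in> switchable. switch \<rho> = \<sigma>})"
    using switch_in_L by auto
  then have "card switchable = card (\<Union>\<sigma>\<in>L. {\<rho> \<in> switchable. switch \<rho> = \<sigma>})" by simp
  also have "\<dots> = (\<Sum>\<sigma>\<in>L. card {\<rho> \<in> switchable. switch \<rho> = \<sigma>})"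
    using finite_switchable finite_L by (intro card_UN_disjoint) auto
  finally show ?thesis .
qed

lemma card_L_le_switchable: "card L * (q - (2 * \<Delta> + 1)) \<le> card switchable"
proof -
  have "q - (2 * \<Delta> + 1) \<le> card {\<rho> \<in> switchable. switch \<rho> = \<sigma>}" if "\<sigma> \<in> L" for \<sigma>
    using card_switch_fibre_ge[OF that] by linarith
  from sum_bounded_below[OF this] show ?thesis by (simp add: card_switchable)
qed

lemma card_not_switchable: "card (R - switchable) * (q - 2 * \<Delta>) \<le> card R * \<Delta>"
proof -
  \<comment> \<open>Switch \<open>\<rho>\<close> at \<open>a\<close> and \<open>k\<close>. This does not move \<open>\<rho>\<^sup>-\<^sup>1 b\<close>, so \<open>k\<close> can be recovered from the result
    up to \<open>\<Delta>\<close> choices, as its new value \<open>\<rho> a\<close> is a nonneighbour of \<open>\<rho>\<^sup>-\<^sup>1 b\<close>.\<close>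
  let ?K = "\<lambda>\<rho>. {k \<in> {1..q}. (a, \<rho> k) \<in> E \<and> (k, \<rho> a) \<in> E}"
  let ?N = "\<lambda>\<rho>. {k \<in> {1..q}. (inv \<rho> b, \<rho> k) \<notin> E}"
  let ?f = "\<lambda>(\<rho>, k). (\<rho> \<circ> Transposition.transpose a k, k)"
  have "q - 2 * \<Delta> \<le> card (?K \<rho>)" if "\<rho> \<in> R - switchable" for \<rho>
  proof -
    have \<rho>: "\<rho> permutes {1..q}" using R_permutes that by blast
    then have "\<rho> a \<in> {1..q}" using a by (simp only: permutes_in_image)
    from card_switches[OF \<rho> a this] show ?thesis by linarith
  qed
  from sum_bounded_below[of "R - switchable" _ "\<lambda>\<rho>. card (?K \<rho>)", OF this]
  have "card (R - switchable) * (q - 2 * \<Delta>) \<le> (\<Sum>\<rho>\<in>R - switchable. card (?K \<rho>))" by simp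
  also have "\<dots> = card (SIGMA \<rho>:R - switchable. ?K \<rho>)"
    using finite_R by simp
  also have "\<dots> \<le> card (SIGMA \<rho>:R. ?N \<rho>)"
  proof (rule card_inj_on_le)
    \<comment> \<open>Since the pair still records \<open>k\<close>, the map \<open>?f\<close> is
      its own inverse.\<close>
    show "inj_on ?f (SIGMA \<rho>:R - switchable. ?K \<rho>)"
      by (rule inj_on_inverseI[of _ ?f]) (auto simp: comp_assoc)
    show "?f ` (SIGMA \<rho>:R - switchable. ?K \<rho>) \<subseteq> (SIGMA \<rho>:R. ?N \<rho>)"
    proof
      fix z assume "z \<in> ?f ` (SIGMA \<rho>:R - switchable. ?K \<rho>)"
      then obtain \<rho> k where \<rho>: "\<rho> \<in> R" "\<rho> \<notin> switchable"
        and k: "k \<in> {1..q}" "(a, \<rho> k) \<in> E" "(k, \<rho> a) \<in> E"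
        and z: "z = (\<rho> \<circ> Transposition.transpose a k, k)" by auto
      define \<tau> where "\<tau> = \<rho> \<circ> Transposition.transpose a k"
      have perm: "\<rho> permutes {1..q}" using \<rho>(1) by (rule R_permutes)
      have \<tau>_pm: "\<tau> \<in> perfect_matchings q E"
        unfolding \<tau>_def using \<rho>(1) a k by (intro perfect_matching_switch) (auto simp: R_def)
      have bad: "(inv \<rho> b, \<rho> a) \<notin> E" using \<rho> by (simp add: switchable_def)
      then have k_neq: "k \<noteq> inv \<rho> b" using k(3) by auto
      have a_neq: "a \<noteq> inv \<rho> b" using \<rho>(1) inv_matching(1)[OF perm] by (auto simp: R_def)
      have "\<tau> (inv \<rho> b) = b"
        using k_neq a_neq inv_matching(1)[OF perm] by (simp add: \<tau>_def)
      then have inv_\<tau>: "inv \<tau> b = inv \<rho> b"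
        using \<tau>_pm by (intro inv_matching(3)) (simp_all add: perfect_matchings_def)
      have "\<tau> a \<noteq> b" using k_neq inv_matching(3)[OF perm, of k] by (auto simp: \<tau>_def)
      then have "\<tau> \<in> R" using \<tau>_pm by (simp add: R_def)
      moreover have "(inv \<tau> b, \<tau> k) \<notin> E" using bad by (simp add: inv_\<tau>, simp add: \<tau>_def)
      ultimately show "z \<in> (SIGMA \<rho>:R. ?N \<rho>)" using k(1) by (simp add: z \<tau>_def)
    qed
    show "finite (SIGMA \<rho>:R. ?N \<rho>)" using finite_R by (intro finite_SigmaI) auto
  qed
  also have "\<dots> = (\<Sum>\<rho>\<in>R. card (?N \<rho>))" using finite_R by simp
  also have "\<dots> \<le> (\<Sum>\<rho>\<in>R. \<Delta>)"
    using R_permutes inv_matching(2) by (intro sum_mono card_permuted_nonneighbours) auto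
  finally show ?thesis by simp
qed

text \<open>Some perfect matching exists. If it lies in \<open>L\<close>, switching backwards
  produces elements of \<open>switchable\<close>, hence of \<open>R\<close>; the bound on
  \<open>q\<close> makes the number of backward switches positive.\<close>

lemma R_nonempty:
  assumes "2 * \<Delta> + 1 < q"
  shows "R \<noteq> {}"
proof
  assume "R = {}"
  then have "L \<noteq> {}" using perfect_matchings_nonempty assms L_Un_R by auto
  then have "card L * (q - (2 * \<Delta> + 1)) > 0" using assms finite_L by (simp add: card_gt_0_iff)
  then have "card switchable > 0" using card_L_le_switchable by linarith
  then show False using \<open>R = {}\<close> by (simp add: switchable_def)
qed

section \<open>Construction of the coupling\<close>

lemma exists_coupling:
  assumes "1 \<le> \<Delta>" "6 * \<Delta> \<le> q"
  shows "\<exists>\<gamma>. is_coupling \<gamma> (pmf_of_set R) (pmf_of_set (L \<union> R)) \<and>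
           measure_pmf.expectation \<gamma> (\<lambda>(\<rho>, \<rho>'). real (cayley_dist q \<rho> \<rho>')) \<le> 8 * real \<Delta> / real q"
proof -
  define l r s where "l = real (card L)" and "r = real (card R)" and "s = real (card switchable)"
  \<comment> \<open>The largest weight safe for both marginals, in units of
    \<open>1 / (l + r)\<close>: a column in \<open>L\<close> receives at most \<open>q\<close>
    switches and has capacity 1, while a row has capacity \<open>(l + r) / r = 1 + l / r\<close>, of
    which the diagonal takes 1.\<close>
  define t where "t = min (1 / real q) (l / r)"
  \<comment> \<open>The scale \<open>1 / (l + r)\<close> is the mass of a point under the second
    marginal, so the diagonal alone fills every column in \<open>R\<close>.\<close>
  define w where "w \<rho> \<sigma> = ((if \<sigma> = \<rho> then 1 else 0)
      + (if \<rho> \<in> switchable \<and> \<sigma> = switch \<rho> then t else 0)) / (l + r)" for \<rho> \<sigma>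
  let ?d = "\<lambda>\<rho> \<sigma>. real (cayley_dist q \<rho> \<sigma>)"
  have R_ne: "R \<noteq> {}" by (rule R_nonempty) (use assms in linarith)
  have fin: "finite (L \<union> R)" using finite_L finite_R by simp
  have card_Un: "real (card (L \<union> R)) = l + r"
    using finite_L finite_R L_Int_R by (simp add: card_Un_disjoint l_def r_def)
  have l: "0 \<le> l" and r: "0 < r" and q: "0 < real q"
    using R_ne finite_R assms by (simp_all add: l_def r_def card_gt_0_iff)
  then have lr: "0 < l + r" by simp
  have t: "0 \<le> t" using l r by (simp add: t_def)
  have sw_R: "switchable \<subseteq> R" by (auto simp: switchable_def)
  have s_r: "s \<le> r" unfolding s_def r_def using sw_R finite_R by (simp add: card_mono)
  have sum_diag: "(\<Sum>\<sigma>\<in>L \<union> R. if \<sigma> = \<rho> then 1 else 0) = (1 :: real)" if "\<rho> \<in> R" for \<rho>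
    using fin that by simp
  have sum_switch: "(\<Sum>\<sigma>\<in>L \<union> R. if \<rho> \<in> switchable \<and> \<sigma> = switch \<rho> then t else 0)
      = (if \<rho> \<in> switchable then t else 0)" for \<rho>
    using fin switch_in_L by simp
  have row_eq: "(\<Sum>\<sigma>\<in>L \<union> R. w \<rho> \<sigma>) = (1 + (if \<rho> \<in> switchable then t else 0)) / (l + r)" if "\<rho> \<in> R" for \<rho>
    unfolding w_def sum_divide_distrib[symmetric] sum.distrib sum_diag[OF that] sum_switch ..
  have sum_t: "(\<Sum>\<rho>\<in>R. if \<rho> \<in> switchable then t else 0) = t * s"
    using sw_R finite_R by (simp add: s_def sum.If_cases Int_absorb1)
  have total: "(\<Sum>\<rho>\<in>R. \<Sum>\<sigma>\<in>L \<union> R. w \<rho> \<sigma>) = (r + t * s) / (l + r)"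
    by (simp add: row_eq sum_divide_distrib[symmetric] sum.distrib sum_t r_def)
  have row: "(\<Sum>\<sigma>\<in>L \<union> R. w \<rho> \<sigma>) \<le> 1 / r" if "\<rho> \<in> R" for \<rho>
  proof -
    have "(\<Sum>\<sigma>\<in>L \<union> R. w \<rho> \<sigma>) \<le> (1 + l / r) / (l + r)"
      unfolding row_eq[OF that] using l r by (intro divide_right_mono) (auto simp: t_def)
    also have "1 + l / r = (l + r) / r" using r by (simp add: add_divide_distrib)
    also have "(l + r) / r / (l + r) = 1 / r" using lr by simp
    finally show ?thesis .
  qed
  have col: "(\<Sum>\<rho>\<in>R. w \<rho> \<sigma>) \<le> 1 / (l + r)" if "\<sigma> \<in> L \<union> R" for \<sigma>
  proof (cases "\<sigma> \<in> L")
    case True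
    then have "\<sigma> \<notin> R" using L_Int_R by blast
    then have "(\<Sum>\<rho>\<in>R. w \<rho> \<sigma>) = (\<Sum>\<rho>\<in>R. if \<rho> \<in> switchable \<and> \<sigma> = switch \<rho> then t else 0) / (l + r)"
      unfolding sum_divide_distrib w_def by (intro sum.cong) auto
    also have "(\<Sum>\<rho>\<in>R. if \<rho> \<in> switchable \<and> \<sigma> = switch \<rho> then t else 0)
        = (\<Sum>\<rho>\<in>{\<rho> \<in> switchable. switch \<rho> = \<sigma>}. t)"
      using sw_R finite_R by (intro sum.mono_neutral_cong_right) auto
    also have "\<dots> = card {\<rho> \<in> switchable. switch \<rho> = \<sigma>} * t" by simp
    also have "\<dots> \<le> real q * (1 / real q)"
      using card_switch_fibre_le[of \<sigma>] t by (intro mult_mono) (auto simp: t_def)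
    finally show ?thesis using q l r by (simp add: divide_right_mono)
  next
    case False
    then have "\<sigma> \<in> R" "\<sigma> \<noteq> switch \<rho>" if "\<rho> \<in> switchable" for \<rho>
      using \<open>\<sigma> \<in> L \<union> R\<close> switch_in_L[OF that] by auto
    then have "(\<Sum>\<rho>\<in>R. w \<rho> \<sigma>) = (\<Sum>\<rho>\<in>R. if \<sigma> = \<rho> then 1 else 0) / (l + r)"
      unfolding sum_divide_distrib w_def by (intro sum.cong) auto
    also have "\<dots> = 1 / (l + r)" using finite_R False that by simp
    finally show ?thesis by simp
  qed
  have cost: "(\<Sum>\<rho>\<in>R. \<Sum>\<sigma>\<in>L \<union> R. w \<rho> \<sigma> * ?d \<rho> \<sigma>) \<le> t * s / (l + r)"
  proof -
    \<comment> \<open>The diagonal part costs nothing since the distance there is 0; only the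
      switches are paid for, at distance at most 1.\<close>
    have "w \<rho> \<sigma> * ?d \<rho> \<sigma> \<le> (if \<rho> \<in> switchable \<and> \<sigma> = switch \<rho> then t else 0) / (l + r)" for \<rho> \<sigma>
    proof (cases "\<rho> \<in> switchable \<and> \<sigma> = switch \<rho>")
      case True
      then have "?d \<rho> \<sigma> \<le> 1" using cayley_dist_switch_le by simp
      moreover have "w \<rho> \<sigma> = t / (l + r)" using True switch_neq by (simp add: w_def)
      ultimately show ?thesis
        using True lr mult_left_le[of "?d \<rho> \<sigma>" t] t by (simp add: divide_right_mono)
    qed (auto simp: w_def cayley_dist_refl)
    then have "(\<Sum>\<rho>\<in>R. \<Sum>\<sigma>\<in>L \<union> R. w \<rho> \<sigma> * ?d \<rho> \<sigma>)
        \<le> (\<Sum>\<rho>\<in>R. \<Sum>\<sigma>\<in>L \<union> R. (if \<rho> \<in> switchable \<and> \<sigma> = switch \<rho> then t else 0) / (l + r))"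
      by (intro sum_mono)
    then show ?thesis by (simp only: sum_divide_distrib[symmetric] sum_switch sum_t)
  qed
  \<comment> \<open>The completion is applied with \<open>D = q\<close>. The mass missing from
    \<open>w\<close> is \<open>(l - t * s) / (l + r)\<close>, the part of \<open>L\<close> not
    reached by switches.\<close>
  have "\<exists>\<gamma>. is_coupling \<gamma> (pmf_of_set R) (pmf_of_set (L \<union> R)) \<and>
      measure_pmf.expectation \<gamma> (\<lambda>(\<rho>, \<sigma>). ?d \<rho> \<sigma>)
        \<le> (\<Sum>\<rho>\<in>set_pmf (pmf_of_set R). \<Sum>\<sigma>\<in>set_pmf (pmf_of_set (L \<union> R)). w \<rho> \<sigma> * ?d \<rho> \<sigma>)
          + real q * (1 - (\<Sum>\<rho>\<in>set_pmf (pmf_of_set R). \<Sum>\<sigma>\<in>set_pmf (pmf_of_set (L \<union> R)). w \<rho> \<sigma>))"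
  proof (rule subcoupling_extends)
    fix \<rho> \<sigma> assume "\<rho> \<in> set_pmf (pmf_of_set R)" "\<sigma> \<in> set_pmf (pmf_of_set (L \<union> R))"
    then have \<rho>\<sigma>: "\<rho> \<in> R" "\<sigma> \<in> L \<union> R" using R_ne fin finite_R by auto
    then show "?d \<rho> \<sigma> \<le> real q"
      using L_permutes R_permutes cayley_dist_le_card[of \<rho> q \<sigma>] by auto
    show "0 \<le> w \<rho> \<sigma>" using t l r by (simp add: w_def)
  qed (use R_ne fin finite_R row col in \<open>simp_all add: card_Un r_def[symmetric]\<close>)
  then obtain \<gamma> where \<gamma>: "is_coupling \<gamma> (pmf_of_set R) (pmf_of_set (L \<union> R))"
    and "measure_pmf.expectation \<gamma> (\<lambda>(\<rho>, \<sigma>). ?d \<rho> \<sigma>)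
      \<le> (\<Sum>\<rho>\<in>R. \<Sum>\<sigma>\<in>L \<union> R. w \<rho> \<sigma> * ?d \<rho> \<sigma>) + real q * (1 - (r + t * s) / (l + r))"
    using R_ne fin finite_R total by auto
  note this(2)
  also have "\<dots> \<le> t * s / (l + r) + real q * (1 - (r + t * s) / (l + r))"
    using cost by simp
  also have "\<dots> = (t * s + real q * (l - t * s)) / (l + r)"
  proof -
    have "1 - (r + t * s) / (l + r) = (l - t * s) / (l + r)" using lr by (simp add: field_simps)
    then show ?thesis by (simp add: add_divide_distrib)
  qed
  also have "\<dots> \<le> 8 * real \<Delta> / real q"
  proof (rule switching_cost_bound[OF l r s_r])
    \<comment> \<open>\<open>\<Delta> \<ge> 1\<close> absorbs the extra 1, as
      \<open>2 * \<Delta> + 1 \<le> 3 * \<Delta>\<close>; \<open>6 * \<Delta> \<le> q\<close> keeps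
      the natural subtraction from truncating.\<close>
    have "l * (real q - 3 * real \<Delta>) \<le> l * real (q - (2 * \<Delta> + 1))"
      using l assms by (intro mult_left_mono) (auto simp: of_nat_diff)
    also have "\<dots> \<le> s"
      using card_L_le_switchable unfolding l_def s_def of_nat_mult[symmetric] of_nat_le_iff .
    finally show "l * (real q - 3 * real \<Delta>) \<le> s" .
    have "real (card (R - switchable)) = r - s"
      using sw_R finite_switchable finite_R by (simp add: card_Diff_subset r_def s_def of_nat_diff card_mono)
    moreover have "real (card (R - switchable)) * real (q - 2 * \<Delta>) \<le> r * real \<Delta>"
      using card_not_switchable unfolding r_def of_nat_mult[symmetric] of_nat_le_iff .
    moreover have "real (q - 2 * \<Delta>) = real q - 2 * real \<Delta>"
      using assms by (simp add: of_nat_diff)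
    ultimately show "(r - s) * (real q - 2 * real \<Delta>) \<le> r * real \<Delta>" by simp
  qed (use assms in \<open>simp_all add: t_def\<close>)
  finally show ?thesis using \<gamma> by blast
qed

end

section \<open>From minimum degree to nonneighbours, and the theorem\<close>

lemma card_nonneighbours_le:
  assumes "A \<subseteq> {1..q}" "int (card A) \<ge> int q - int \<Delta>"
  shows "card {j \<in> {1..q}. j \<notin> A} \<le> \<Delta>"
proof -
  have "finite A" using assms(1) finite_subset by blast
  moreover have "{j \<in> {1..q}. j \<notin> A} = {1..q} - A" by blast
  ultimately have "card {j \<in> {1..q}. j \<notin> A} = q - card A"
    using assms(1) by (simp add: card_Diff_subset)
  then show ?thesis using assms(2) by linarith
qed

text \<open>\<open>bip_degree\<close> counts neighbours among all naturals, while the locale counts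
  nonneighbours within \<open>{1..q}\<close>; they are complementary because \<open>E\<close> lies
  inside the square.\<close>

lemma dense_bipartite_of_degree:
  assumes "E \<subseteq> {1..q} \<times> {1..q}"
    and deg: "\<forall>v \<in> bip_vertices q. int (bip_degree E v) \<ge> int q - int \<Delta>"
  shows "dense_bipartite q \<Delta> E"
proof
  fix i assume i: "i \<in> {1..q}"
  have "int (bip_degree E (Inl i)) \<ge> int q - int \<Delta>" "int (bip_degree E (Inr i)) \<ge> int q - int \<Delta>"
    using deg i by (simp_all add: bip_vertices_def InlI InrI del: bip_degree.simps)
  moreover have "{j. (i, j) \<in> E} \<subseteq> {1..q}" "{j. (j, i) \<in> E} \<subseteq> {1..q}" using assms(1) by blast+
  ultimately show "card {j \<in> {1..q}. (i, j) \<notin> E} \<le> \<Delta>" "card {j \<in> {1..q}. (j, i) \<notin> E} \<le> \<Delta>"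
    using card_nonneighbours_le[of "{j. (i, j) \<in> E}" q \<Delta>]
      card_nonneighbours_le[of "{j. (j, i) \<in> E}" q \<Delta>] by simp_all
qed

theorem lemma2p2:
  "\<exists>C1 C2 :: real. \<forall>(\<Delta> :: nat) (q :: nat) (E :: (nat \<times> nat) set) (e :: nat \<times> nat).
     \<Delta> \<ge> 1 \<longrightarrow> real q \<ge> C1 * real \<Delta> \<longrightarrow>
     E \<subseteq> {1..q} \<times> {1..q} \<longrightarrow>
     (\<forall>v \<in> bip_vertices q. int (bip_degree E v) \<ge> int q - int \<Delta>) \<longrightarrow>
     e \<in> E \<longrightarrow>
     (let L = {\<rho> \<in> perfect_matchings q E. e \<in> matching_edges q \<rho>};
          R = {\<rho> \<in> perfect_matchings q E. e \<notin> matching_edges q \<rho>}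
      in R \<noteq> {} \<and>
         (\<exists>\<gamma>. is_coupling \<gamma> (pmf_of_set R) (pmf_of_set (L \<union> R)) \<and>
              measure_pmf.expectation \<gamma> (\<lambda>(\<rho>, \<rho>'). real (cayley_dist q \<rho> \<rho>'))
                \<le> C2 * real \<Delta> / real q))"
proof (rule exI[of _ 6], rule exI[of _ 8], intro allI impI)
  fix \<Delta> q :: nat and E :: "(nat \<times> nat) set" and e :: "nat \<times> nat"
  assume \<Delta>: "\<Delta> \<ge> 1" and "real q \<ge> 6 * real \<Delta>" and E: "E \<subseteq> {1..q} \<times> {1..q}"
    and deg: "\<forall>v \<in> bip_vertices q. int (bip_degree E v) \<ge> int q - int \<Delta>" and "e \<in> E"
  obtain a b where e: "e = (a, b)" by (cases e)
  have q: "6 * \<Delta> \<le> q" using \<open>real q \<ge> 6 * real \<Delta>\<close> by linarith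
  interpret dense_bipartite q \<Delta> E using E deg by (rule dense_bipartite_of_degree)
  interpret dense_bipartite_edge q \<Delta> E a b
    by unfold_locales (use \<open>e \<in> E\<close> E e in blast)+
  have mem: "e \<in> matching_edges q \<rho> \<longleftrightarrow> \<rho> a = b" for \<rho>
    using a by (auto simp: e matching_edges_def)
  \<comment> \<open>Nonemptiness of \<open>R\<close> is what makes \<open>pmf_of_set R\<close>, and
    with it \<open>pmf_of_set (L \<union> R)\<close>, a genuine uniform distribution.\<close>
  have "R \<noteq> {}" by (rule R_nonempty) (use \<Delta> q in linarith)
  with exists_coupling[OF \<Delta> q] show
    "let L = {\<rho> \<in> perfect_matchings q E. e \<in> matching_edges q \<rho>};
         R = {\<rho> \<in> perfect_matchings q E. e \<notin> matching_edges q \<rho>}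
     in R \<noteq> {} \<and>
        (\<exists>\<gamma>. is_coupling \<gamma> (pmf_of_set R) (pmf_of_set (L \<union> R)) \<and>
             measure_pmf.expectation \<gamma> (\<lambda>(\<rho>, \<rho>'). real (cayley_dist q \<rho> \<rho>'))
               \<le> 8 * real \<Delta> / real q)"
    unfolding mem Let_def L_def R_def by blast
qed

end
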